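(* Let $n \in \mathbb{N}$ be such that $n+1$ is a prime number. Then there exists $x_n \in (0,1)$ such that $$P_{n+1}(x_n) < P_n(x_n).$$
   Context: $\mathbb{N} = \{1,2,3,\ldots\}$. For $n \in \mathbb{N}$ let $\sigma(n) := \sum_{d \mid n} d$ be the sum of the positive divisors of $n$. The polynomials $P_n(x)$ are defined recursively by $P_0(x) := 1$ and, for $n \geq 1$, $P_n(x) := \frac{x}{n} \sum_{k=1}^{n} \sigma(k)\, P_{n-k}(x)$. Equivalently, $\sum_{n=0}^{\infty} P_n(z)\, q^n = \prod_{n=1}^{\infty} (1-q^n)^{-z}$ for $z \in \mathbb{C}$, where $q = e^{2\pi i \tau}$ with $\tau$ in the complex upper half-plane. For $k \in \mathbb{N}$, $P_n(k)$ is the number of $k$-colored partitions of $n$ (partitions of $n$ in which each part can appear in $k$ colors).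
   Formalization: The case n = 1 is excluded (n ≥ 2 is assumed), because the claim is false there: P_1(x) = x and P_2(x) = x(x+3)/2, so P_2(x) < P_1(x) holds for no x in (0,1). *)

theory Defs
  imports "HOL-Computational_Algebra.Computational_Algebra"
begin

definition divisor_sigma :: "nat \<Rightarrow> nat" where
  "divisor_sigma n = (\<Sum>d | d dvd n. d)"

text \<open>The recursion \<open>P\<^sub>n(x) = (x / n) \<Sum>\<^sub>k \<sigma>(k) P\<^sub>n\<^sub>-\<^sub>k(x)\<close> for \<open>1 \<le> k \<le> n\<close>, read in the polynomial
  ring over the reals, so that \<open>[:0, 1 / n:]\<close> stands for \<open>x / n\<close>.\<close>

fun P :: "nat \<Rightarrow> real poly" where
  "P 0 = 1"
| "P (Suc m) = [:0, 1 / real (Suc m):] *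
     (\<Sum>k = 1..Suc m. smult (real (divisor_sigma k)) (P (Suc m - k)))"

text \<open>The case \<open>n = 1\<close> must be excluded from the theorem: \<open>n + 1 = 2\<close> is prime, but the
  inequality fails for every \<open>x\<close> in \<open>(0, 1)\<close>, as \<open>P\<^sub>1(x) = x\<close> and \<open>P\<^sub>2(x) = x (x + 3) / 2\<close>.\<close>

lemma P_case_1_fails:
  "\<not> (\<exists>x::real. x \<in> {0<..<1} \<and> poly (P (1 + 1)) x < poly (P 1) x)"
proof -
  have "{d::nat. d dvd 2} = {1, 2}"
    using prime_nat_iff[of 2] two_is_prime_nat by auto
  then have s: "divisor_sigma 1 = 1" "divisor_sigma 2 = 3"
    by (simp_all add: divisor_sigma_def)
  have iv: "{1..Suc (Suc 0)} = {1, 2}"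
    by auto
  have p1: "poly (P 1) x = x" for x
    using s by simp
  have p2: "poly (P (1 + 1)) x = x * (x + 3) / 2" for x
    using s by (simp add: iv numeral_2_eq_2 algebra_simps)
  have "x \<le> x * (x + 3) / 2" if "0 < x" for x :: real
    using that by (simp add: field_simps)
  then show ?thesis
    unfolding p1 p2 by (auto simp: not_less)
qed

end

theory Submission
  imports Defs
begin

text \<open>
  The inequality already holds to first order at the origin. For \<open>m \<ge> 1\<close> the polynomial
  \<open>P\<^sub>m\<close> vanishes at \<open>0\<close>, so in the recursion only the summand \<open>k = m\<close>, with its factor
  \<open>P\<^sub>0 = 1\<close>, contributes to the linear term (\<open>coeff_P_1\<close>): the slope of \<open>P\<^sub>m\<close> at \<open>0\<close> is
  \<open>\<sigma>(m) / m\<close>. For the prime \<open>p = n + 1\<close> the slope is only \<open>1 + 1 / p\<close>, and this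
  is less than \<open>1 + 1 / n \<le> \<sigma>(n) / n\<close>. Hence \<open>P\<^sub>n - P\<^sub>n\<^sub>+\<^sub>1\<close> vanishes at \<open>0\<close> with positive
  derivative, and is positive at all sufficiently small \<open>x > 0\<close>.
\<close>

lemma coeff_P_0: "coeff (P m) 0 = (if m = 0 then 1 else 0)"
  by (cases m) (simp_all del: sum.cl_ivl_Suc)

lemma coeff_P_1:
  assumes "m > 0"
  shows "coeff (P m) 1 = real (divisor_sigma m) / real m"
proof -
  obtain j where m: "m = Suc j"
    using assms gr0_conv_Suc by blast
  have "(\<Sum>k = 1..m. real (divisor_sigma k) * coeff (P (m - k)) 0) =
        (\<Sum>k = 1..m. if k = m then real (divisor_sigma m) else 0)"
    by (intro sum.cong) (auto simp: coeff_P_0)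
  also have "\<dots> = real (divisor_sigma m)"
    using assms by simp
  finally show ?thesis
    unfolding m by (simp add: coeff_sum del: sum.cl_ivl_Suc)
qed

lemma divisor_sigma_ge:
  assumes "n \<ge> 2"
  shows "divisor_sigma n \<ge> n + 1"
proof -
  have "\<Sum>{1, n} \<le> \<Sum>{d. d dvd n}"
    using assms by (intro sum_mono2) auto
  then show ?thesis
    using assms by (simp add: divisor_sigma_def)
qed

lemma divisor_sigma_prime:
  assumes "prime p"
  shows "divisor_sigma p = p + 1"
proof -
  have "{d. d dvd p} = {1, p}"
    using assms by (auto simp: prime_nat_iff)
  then show ?thesis
    using prime_gt_1_nat[OF assms] by (simp add: divisor_sigma_def)
qed

lemma poly_less_right_of_0:
  fixes p q :: "real poly"
  assumes "coeff p 0 = coeff q 0" and "coeff p 1 < coeff q 1"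
  shows "\<exists>x \<in> {0<..<1}. poly p x < poly q x"
proof -
  have "coeff q 1 - coeff p 1 = poly (pderiv (q - p)) 0"
    by (simp add: poly_0_coeff_0 coeff_pderiv)
  then have "poly (pderiv (q - p)) 0 > 0"
    using assms(2) by linarith
  then obtain e where "e > 0"
    and e: "\<And>h. 0 < h \<Longrightarrow> h < e \<Longrightarrow> poly (q - p) 0 < poly (q - p) (0 + h)"
    using DERIV_pos_inc_right[OF poly_DERIV] by blast
  have "poly (q - p) 0 = 0"
    using assms(1) by (simp add: poly_0_coeff_0)
  then have "poly p (min e 1 / 2) < poly q (min e 1 / 2)"
    using e[of "min e 1 / 2"] \<open>e > 0\<close> by simp
  then show ?thesis
    using \<open>e > 0\<close> by (intro bexI[of _ "min e 1 / 2"]) auto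
qed

theorem mainTheorem3:
  fixes n :: nat
  assumes "n \<ge> 2" and "prime (n + 1)"
  shows "\<exists>x::real. x \<in> {0<..<1} \<and> poly (P (n + 1)) x < poly (P n) x"
proof -
  have "coeff (P (n + 1)) 1 = real (n + 2) / real (n + 1)"
    using coeff_P_1[of "n + 1"] divisor_sigma_prime[OF assms(2)] by simp
  also have "\<dots> < real (n + 1) / real n"
    using assms(1) by (simp add: field_simps)
  also have "\<dots> \<le> real (divisor_sigma n) / real n"
    using divisor_sigma_ge[OF assms(1)] by (intro divide_right_mono) linarith+
  also have "\<dots> = coeff (P n) 1"
    using assms(1) coeff_P_1[of n] by simp
  finally have "coeff (P (n + 1)) 1 < coeff (P n) 1" .
  moreover have "coeff (P (n + 1)) 0 = coeff (P n) 0"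
    using assms(1) coeff_P_0[of n] coeff_P_0[of "n + 1"] by simp
  ultimately show ?thesis
    using poly_less_right_of_0 by blast
qed

end
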